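(* Let $b\ge 1$ be an integer and let $|\gamma(z)\rangle=\sum_{k=0}^{2^b-1}|\gamma_k\rangle z^k$ be a $2^b$-dimensional polynomial state of degree $\le 2^b-1$. Let $\tilde w_b=\tilde w_b(z)=\operatorname{diag}(1,z,z^2,\dots,z^{2^b-1})$. There exist $A_0,A_1\in SU(2^b)$ (independent of $z$) such that $$A_1\,\tilde w_b\,A_0\,|0\rangle=|\gamma(z)\rangle\qquad\text{for all } z\in U(1)$$ if and only if the coefficient vectors $\{|\gamma_k\rangle\}_{0\le k\le 2^b-1}$ are pairwise orthogonal.
   Context: $U(1)=\{z\in\mathbb{C}:|z|=1\}$. $|0\rangle,\dots,|2^b-1\rangle$ is the standard orthonormal basis of $\mathbb{C}^{2^b}$. An $m$-dimensional polynomial state is a vector-valued polynomial $|\gamma(z)\rangle=\sum_{k\ge 0}|\gamma_k\rangle z^k$ (finite sum, coefficient vectors $|\gamma_k\rangle\in\mathbb{C}^m$, possibly zero) such that $\langle\gamma(z)|\gamma(z)\rangle=1$ for every $z\in U(1)$. Its degree is the highest $k$ with $|\gamma_k\rangle\ne 0$. Pairwise orthogonal means $\langle\gamma_k|\gamma_\ell\rangle=0$ for all $k\ne\ell$ (zero vectors are allowed). *)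

theory Defs
  imports "Jordan_Normal_Form.Schur_Decomposition"
begin

definition U1 :: "complex set" where
  "U1 = {z. cmod z = 1}"

definition unitary_mat :: "nat \<Rightarrow> complex mat \<Rightarrow> bool" where
  "unitary_mat n A \<longleftrightarrow>
     A \<in> carrier_mat n n \<and> mat_adjoint A * A = 1\<^sub>m n \<and> A * mat_adjoint A = 1\<^sub>m n"

definition SU :: "nat \<Rightarrow> complex mat set" where
  "SU n = {A. unitary_mat n A \<and> det A = 1}"

(* The Dirac inner product is conjugate-linear in its first argument, whereas
   \<open>\<bullet>c\<close> conjugates its second argument. *)
definition braket :: "complex vec \<Rightarrow> complex vec \<Rightarrow> complex" where
  "braket u v = v \<bullet>c u"

(* An m-dimensional vector-valued polynomial is encoded by its sequence of
   coefficient vectors, which all lie in \<open>carrier_vec m\<close> and almost all vanish. *)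
definition vec_poly :: "nat \<Rightarrow> (nat \<Rightarrow> complex vec) \<Rightarrow> bool" where
  "vec_poly m \<gamma> \<longleftrightarrow> (\<forall>k. \<gamma> k \<in> carrier_vec m) \<and> finite {k. \<gamma> k \<noteq> 0\<^sub>v m}"

definition vec_poly_eval :: "nat \<Rightarrow> (nat \<Rightarrow> complex vec) \<Rightarrow> complex \<Rightarrow> complex vec" where
  "vec_poly_eval m \<gamma> z =
     finsum_vec TYPE(complex) m (\<lambda>k. z ^ k \<cdot>\<^sub>v \<gamma> k) {k. \<gamma> k \<noteq> 0\<^sub>v m}"

(* Unspecified for the zero polynomial, which is never a polynomial state. *)
definition vec_poly_degree :: "nat \<Rightarrow> (nat \<Rightarrow> complex vec) \<Rightarrow> nat" where
  "vec_poly_degree m \<gamma> = Max {k. \<gamma> k \<noteq> 0\<^sub>v m}"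

definition polynomial_state :: "nat \<Rightarrow> (nat \<Rightarrow> complex vec) \<Rightarrow> bool" where
  "polynomial_state m \<gamma> \<longleftrightarrow>
     vec_poly m \<gamma> \<and>
     (\<forall>z\<in>U1. braket (vec_poly_eval m \<gamma> z) (vec_poly_eval m \<gamma> z) = 1)"

definition w_tilde :: "nat \<Rightarrow> complex \<Rightarrow> complex mat" where
  "w_tilde b z = mat_diag (2 ^ b) (\<lambda>k. z ^ k)"

end

theory Submission
  imports Defs
begin

text \<open>
  Comparing coefficients, the circuit identity says \<open>\<gamma>\<^sub>k = a\<^sub>k u\<^sub>k\<close>, where \<open>a\<close> is the first
  column of \<open>A\<^sub>0\<close> and the \<open>u\<^sub>k\<close> are the columns of \<open>A\<^sub>1\<close>. Hence the \<open>\<gamma>\<^sub>k\<close> are pairwise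
  orthogonal. Conversely, an orthogonal family of \<open>n\<close> vectors in \<open>\<complex>\<^sup>n\<close> consists of multiples
  \<open>\<gamma>\<^sub>k = a\<^sub>k u\<^sub>k\<close> of an orthonormal basis; the state condition at \<open>z = 1\<close> makes \<open>a\<close> a unit
  vector, which is completed to a unitary matrix. The determinants are corrected by
  multiplying a single column by a phase, which for \<open>A\<^sub>1\<close> is absorbed into \<open>a\<^sub>0\<close>, and for
  \<open>A\<^sub>0\<close> is harmless in the second column because \<open>2\<^sup>b \<ge> 2\<close>.
\<close>

section \<open>Inner products, adjoints and unitary matrices\<close>

lemma braket_eq_sum:
  assumes "u \<in> carrier_vec n" "v \<in> carrier_vec n"
  shows "braket u v = (\<Sum>i<n. v $ i * cnj (u $ i))"
  using assms unfolding braket_def scalar_prod_def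
  by (auto simp: atLeast0LessThan conjugate_complex_def intro!: sum.cong)

lemma braket_eq_0_commute:
  assumes "u \<in> carrier_vec n" "v \<in> carrier_vec n"
  shows "braket u v = 0 \<longleftrightarrow> braket v u = 0"
proof -
  have "braket v u = cnj (braket u v)"
    using assms by (simp add: braket_eq_sum mult.commute)
  then show ?thesis by simp
qed

lemma braket_smult:
  assumes "u \<in> carrier_vec n" "v \<in> carrier_vec n"
  shows "braket (a \<cdot>\<^sub>v u) (c \<cdot>\<^sub>v v) = cnj a * c * braket u v"
  using assms by (simp add: braket_eq_sum sum_distrib_left mult_ac)

lemma braket_self_eq_0_iff:
  assumes "u \<in> carrier_vec n"
  shows "braket u u = 0 \<longleftrightarrow> u = 0\<^sub>v n"
  using assms unfolding braket_def by simp

lemma braket_self: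
  assumes "u \<in> carrier_vec n"
  shows "braket u u = of_real (\<Sum>i<n. (cmod (u $ i))\<^sup>2)"
  using assms by (simp add: braket_eq_sum complex_norm_square[symmetric] del: of_real_power)

lemma mat_adjoint_eq:
  assumes "A \<in> carrier_mat m n"
  shows "mat_adjoint A = transpose_mat (map_mat cnj A)"
  using assms
  by (intro eq_matI) (auto simp: mat_adjoint_def mat_of_rows_def conjugate_complex_def)

lemma mat_adjoint_carrier:
  fixes A :: "complex mat"
  assumes "A \<in> carrier_mat m n"
  shows "mat_adjoint A \<in> carrier_mat n m"
  using assms by (simp add: mat_adjoint_eq[OF assms])

lemma det_mat_adjoint:
  assumes "A \<in> carrier_mat n n"
  shows "det (mat_adjoint A) = cnj (det A)"
proof -
  \<comment> \<open>Conjugation is a ring homomorphism, so it commutes with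
    \<open>det\<close>.\<close>
  interpret cnj: comm_ring_hom cnj
    by unfold_locales auto
  have "det (mat_adjoint A) = det (map_mat cnj A)"
    unfolding mat_adjoint_eq[OF assms] by (rule det_transpose) (use assms in auto)
  then show ?thesis by simp
qed

lemma mat_adjoint_mult_index:
  assumes "A \<in> carrier_mat n n" "i < n" "j < n"
  shows "(mat_adjoint A * A) $$ (i, j) = braket (col A i) (col A j)"
  using assms
  by (subst braket_eq_sum[of _ n])
     (auto simp: mat_adjoint_eq scalar_prod_def atLeast0LessThan intro!: sum.cong)

text \<open>The entries of \<open>mat_adjoint A * A\<close> are the inner products of the columns.
  For square matrices a left inverse is also a right inverse, so one of the two products in
  \<open>unitary_mat\<close> suffices.\<close>

lemma unitary_mat_iff_orthonormal_cols:
  "unitary_mat n A \<longleftrightarrow> A \<in> carrier_mat n n \<and>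
     (\<forall>i<n. \<forall>j<n. braket (col A i) (col A j) = (if i = j then 1 else 0))"
    (is "_ \<longleftrightarrow> _ \<and> ?O")
proof (cases "A \<in> carrier_mat n n")
  case A: True
  note A' = mat_adjoint_carrier[OF A]
  have "mat_adjoint A * A = 1\<^sub>m n \<longleftrightarrow> ?O"
  proof
    assume "mat_adjoint A * A = 1\<^sub>m n"
    then show ?O using mat_adjoint_mult_index[OF A] by (metis index_one_mat(1))
  next
    assume ?O
    then show "mat_adjoint A * A = 1\<^sub>m n"
      using A A' mat_adjoint_mult_index[OF A] by (intro eq_matI) auto
  qed
  moreover have "mat_adjoint A * A = 1\<^sub>m n \<Longrightarrow> A * mat_adjoint A = 1\<^sub>m n"
    using mat_mult_left_right_inverse[OF A' A] .
  ultimately show ?thesis using A unfolding unitary_mat_def by blast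
qed (simp add: unitary_mat_def)

lemma unitary_mat_carrier: "unitary_mat n A \<Longrightarrow> A \<in> carrier_mat n n"
  unfolding unitary_mat_def by blast

text \<open>Moved across the inner product, \<open>U\<close> becomes its adjoint and cancels. This
  serves to carry the unit norm of the state at z = 1 over to the first column of
  \<open>A0\<close>.\<close>

lemma braket_unitary_mat_mult:
  assumes U: "unitary_mat n U" and x: "x \<in> carrier_vec n"
  shows "braket (U *\<^sub>v x) (U *\<^sub>v x) = braket x x"
proof -
  note C = unitary_mat_carrier[OF U]
  note C' = mat_adjoint_carrier[OF C]
  have adj: "braket y (U *\<^sub>v x) = braket (mat_adjoint U *\<^sub>v y) x"
    if y: "y \<in> carrier_vec n" for y
  proof -
    have "braket y (U *\<^sub>v x) = (\<Sum>i<n. \<Sum>k<n. U $$ (i, k) * x $ k * cnj (y $ i))"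
      using C x y
      by (subst braket_eq_sum[of _ n])
         (auto simp: scalar_prod_def atLeast0LessThan sum_distrib_right intro!: sum.cong)
    also have "\<dots> = (\<Sum>k<n. \<Sum>i<n. U $$ (i, k) * x $ k * cnj (y $ i))"
      by (rule sum.swap)
    also have "\<dots> = braket (mat_adjoint U *\<^sub>v y) x"
      using C C' x y
      by (subst braket_eq_sum[of _ n])
         (auto simp: mat_adjoint_eq[OF C] scalar_prod_def atLeast0LessThan
            sum_distrib_left mult_ac intro!: sum.cong)
    finally show ?thesis .
  qed
  have "mat_adjoint U *\<^sub>v (U *\<^sub>v x) = (mat_adjoint U * U) *\<^sub>v x"
    using C C' x by (simp add: assoc_mult_mat_vec)
  also have "\<dots> = x"
    using U x unfolding unitary_mat_def by simp
  finally show ?thesis using adj[of "U *\<^sub>v x"] C x by simp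
qed

section \<open>Columns, diagonal factors and determinants\<close>

lemma mult_mat_unit_vec:
  fixes A :: "'a :: semiring_1 mat"
  assumes "A \<in> carrier_mat m n" "j < n"
  shows "A *\<^sub>v unit_vec n j = col A j"
  using assms scalar_prod_right_unit[of j n] by (intro eq_vecI) auto

lemma col_mult_mat_diag:
  fixes A :: "'a :: comm_semiring_0 mat"
  assumes "A \<in> carrier_mat n n" "k < n"
  shows "col (A * mat_diag n d) k = d k \<cdot>\<^sub>v col A k"
  using assms by (intro eq_vecI) (auto simp: mat_diag_mult_right mult.commute)

lemma unitary_mat_mult_mat_diag:
  assumes U: "unitary_mat n U" and d: "\<And>k. k < n \<Longrightarrow> cmod (d k) = 1"
  shows "unitary_mat n (U * mat_diag n d)"
proof -
  note C = unitary_mat_carrier[OF U]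
  have "cnj (d k) * d k = 1" if "k < n" for k
    using d[OF that] complex_norm_square[of "d k"] by (simp add: mult.commute)
  then show ?thesis
    using U C unfolding unitary_mat_iff_orthonormal_cols
    by (auto simp: col_mult_mat_diag[OF C] braket_smult[of _ n])
qed

lemma det_mat_diag: "det (mat_diag n d) = (\<Prod>i<n. d i)" for d :: "nat \<Rightarrow> complex"
proof -
  have "det (mat_diag n d) = prod_list (diag_mat (mat_diag n d))"
    by (rule det_upper_triangular) (auto simp: mat_diag_def)
  also have "diag_mat (mat_diag n d) = map d [0..<n]"
    unfolding diag_mat_def by (auto simp: mat_diag_def)
  finally show ?thesis
    by (simp add: prod.distinct_set_conv_list[symmetric] atLeast0LessThan)
qed

text \<open>The adjoint has the conjugate determinant, so taking determinants in
  \<open>U * mat_adjoint U\<close> gives the squared modulus.\<close>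

lemma cmod_det_unitary_mat:
  assumes U: "unitary_mat n U"
  shows "cmod (det U) = 1"
proof -
  note C = unitary_mat_carrier[OF U]
  have "det U * cnj (det U) = det (U * mat_adjoint U)"
    using det_mult[OF C mat_adjoint_carrier[OF C]] det_mat_adjoint[OF C] by simp
  also have "\<dots> = 1" using U unfolding unitary_mat_def by simp
  finally have "complex_of_real ((cmod (det U))\<^sup>2) = 1"
    by (simp only: complex_norm_square)
  then have "(cmod (det U))\<^sup>2 = 1" by (simp only: of_real_eq_1_iff)
  then show ?thesis using power_eq_imp_eq_base[of "cmod (det U)" 2 1] by simp
qed

text \<open>Scaling one column by \<open>inverse (det U)\<close>, a phase, makes the determinant 1.
  The column \<open>j\<close> is left free: for \<open>A1\<close> it is column 0, and for
  \<open>A0\<close> it is column 1, which leaves the prescribed first column intact.\<close>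

lemma unitary_mat_adjust_det:
  assumes U: "unitary_mat n U" and j: "j < n"
  obtains V c where "V \<in> SU n" "c \<noteq> 0" "col V j = c \<cdot>\<^sub>v col U j"
    "\<And>k. k < n \<Longrightarrow> k \<noteq> j \<Longrightarrow> col V k = col U k"
proof -
  note C = unitary_mat_carrier[OF U]
  define c where "c = inverse (det U)"
  define d where "d = (\<lambda>k. if k = j then c else 1)"
  have c: "cmod c = 1" unfolding c_def norm_inverse cmod_det_unitary_mat[OF U] by simp
  then have c0: "c \<noteq> 0" by auto
  have "det (mat_diag n d) = c"
    unfolding det_mat_diag d_def using j by simp
  moreover have "det U * c = 1" using c0 unfolding c_def by simp
  ultimately have "det (U * mat_diag n d) = 1"
    unfolding det_mult[OF C mat_diag_dim] by simp
  moreover have "unitary_mat n (U * mat_diag n d)"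
    by (rule unitary_mat_mult_mat_diag[OF U]) (simp add: d_def c)
  ultimately have V: "U * mat_diag n d \<in> SU n" unfolding SU_def by blast
  have col: "col (U * mat_diag n d) k = (if k = j then c else 1) \<cdot>\<^sub>v col U k" if "k < n" for k
    unfolding col_mult_mat_diag[OF C that] d_def ..
  show thesis
  proof (rule that[of "U * mat_diag n d" c])
    show "col (U * mat_diag n d) j = c \<cdot>\<^sub>v col U j"
      unfolding col[OF j] by simp
    show "col (U * mat_diag n d) k = col U k" if "k < n" "k \<noteq> j" for k
      unfolding col[OF \<open>k < n\<close>] using \<open>k \<noteq> j\<close> by simp
  qed (fact V c0)+
qed

section \<open>Orthogonal families as multiples of orthonormal bases\<close>

text \<open>A zero member can be replaced: the matrix with the conjugated family as its rows is
  singular, and a nonzero kernel vector is orthogonal to all the other members.\<close>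

lemma orthogonal_family_replace_zeros:
  fixes v :: "nat \<Rightarrow> complex vec"
  assumes "\<And>k. k < n \<Longrightarrow> v k \<in> carrier_vec n"
    and "\<And>k l. k < n \<Longrightarrow> l < n \<Longrightarrow> k \<noteq> l \<Longrightarrow> braket (v k) (v l) = 0"
  shows "\<exists>w. \<forall>k<n. w k \<in> carrier_vec n \<and> w k \<noteq> 0\<^sub>v n \<and> (v k \<noteq> 0\<^sub>v n \<longrightarrow> w k = v k) \<and>
           (\<forall>l<n. k \<noteq> l \<longrightarrow> braket (w k) (w l) = 0)"
  using assms
\<comment> \<open>The induction is on the number of zero members; replacing one of them lowers
  it.\<close>
proof (induction "card {k. k < n \<and> v k = 0\<^sub>v n}" arbitrary: v rule: less_induct)
  case less
  note v = less.prems(1) and orth = less.prems(2)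
  show ?case
  proof (cases "\<exists>k<n. v k = 0\<^sub>v n")
    case False
    then show ?thesis using v orth by (intro exI[of _ v]) auto
  next
    case True
    then obtain j where j: "j < n" "v j = 0\<^sub>v n" by blast
    \<comment> \<open>The conjugation makes \<open>A *\<^sub>v x\<close> the list of all
      \<open>braket (v i) x\<close>, so the kernel of \<open>A\<close> is the orthogonal complement
      of the family.\<close>
    define A where "A = mat n n (\<lambda>(i, k). cnj (v i $ k))"
    have A: "A \<in> carrier_mat n n" unfolding A_def by simp
    have "(A *\<^sub>v x) $ i = braket (v i) x" if "i < n" "x \<in> carrier_vec n" for i x
      using that v[OF that(1)]
      by (subst braket_eq_sum[of _ n])
         (auto simp: A_def scalar_prod_def atLeast0LessThan intro!: sum.cong)
    note Ax = this
    have A_row: "row A j = 0\<^sub>v n"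
      using j by (intro eq_vecI) (auto simp: A_def)
    \<comment> \<open>Row \<open>j\<close> vanishes because \<open>v j\<close> does, so the
      transpose annihilates the \<open>j\<close>-th unit vector.\<close>
    have "det A = 0"
    proof -
      have "transpose_mat A *\<^sub>v unit_vec n j = 0\<^sub>v n"
        using A A_row j by (simp add: mult_mat_unit_vec)
      moreover have "unit_vec n j \<noteq> (0\<^sub>v n :: complex vec)" using j by simp
      ultimately have "det (transpose_mat A) = 0"
        using det_0_iff_vec_prod_zero[of "transpose_mat A" n] unit_vec_carrier[of n j]
        unfolding transpose_carrier_mat using A by blast
      then show ?thesis using det_transpose[OF A] by simp
    qed
    then obtain x where x: "x \<in> carrier_vec n" "x \<noteq> 0\<^sub>v n" "A *\<^sub>v x = 0\<^sub>v n"
      using det_0_iff_vec_prod_zero[OF A] by blast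
    have vx: "braket (v i) x = 0" "braket x (v i) = 0" if "i < n" for i
    proof -
      show "braket (v i) x = 0" using Ax[OF that x(1)] x(3) that by simp
      then show "braket x (v i) = 0" using braket_eq_0_commute[OF v[OF that] x(1)] by simp
    qed
    define v' where "v' = v(j := x)"
    have "{k. k < n \<and> v' k = 0\<^sub>v n} \<subset> {k. k < n \<and> v k = 0\<^sub>v n}"
      using j x(2) unfolding v'_def by auto
    then have "card {k. k < n \<and> v' k = 0\<^sub>v n} < card {k. k < n \<and> v k = 0\<^sub>v n}"
      by (intro psubset_card_mono) auto
    moreover have "v' k \<in> carrier_vec n" if "k < n" for k
      using v x that by (simp add: v'_def)
    moreover have "braket (v' k) (v' l) = 0" if "k < n" "l < n" "k \<noteq> l" for k l
      using orth that vx by (simp add: v'_def)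
    ultimately obtain w where w: "\<forall>k<n. w k \<in> carrier_vec n \<and> w k \<noteq> 0\<^sub>v n \<and>
        (v' k \<noteq> 0\<^sub>v n \<longrightarrow> w k = v' k) \<and> (\<forall>l<n. k \<noteq> l \<longrightarrow> braket (w k) (w l) = 0)"
      using less.hyps[of v'] by blast
    \<comment> \<open>At \<open>k = j\<close> the claim is vacuous since \<open>v j\<close> is zero;
      elsewhere \<open>v'\<close> agrees with \<open>v\<close>.\<close>
    have "v k \<noteq> 0\<^sub>v n \<longrightarrow> w k = v k" if "k < n" for k
      using w that j unfolding v'_def by (cases "k = j") auto
    then show ?thesis using w by (intro exI[of _ w]) blast
  qed
qed

text \<open>Once its zero members are replaced, the family can be normalised, and its
  \<open>n\<close> vectors fill a square matrix. The factor \<open>r k\<close> is the norm of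
  \<open>v k\<close>, hence 0 where \<open>v k\<close> is zero and the column is a
  replacement.\<close>

lemma orthogonal_family_unitary_cols:
  fixes v :: "nat \<Rightarrow> complex vec"
  assumes v: "\<And>k. k < n \<Longrightarrow> v k \<in> carrier_vec n"
    and orth: "\<And>k l. k < n \<Longrightarrow> l < n \<Longrightarrow> k \<noteq> l \<Longrightarrow> braket (v k) (v l) = 0"
  obtains U r where "unitary_mat n U" "\<And>k. k < n \<Longrightarrow> v k = r k \<cdot>\<^sub>v col U k"
proof -
  obtain w where "\<forall>k<n. w k \<in> carrier_vec n \<and> w k \<noteq> 0\<^sub>v n \<and> (v k \<noteq> 0\<^sub>v n \<longrightarrow> w k = v k) \<and>
      (\<forall>l<n. k \<noteq> l \<longrightarrow> braket (w k) (w l) = 0)"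
    using orthogonal_family_replace_zeros[of n v, OF v orth] by (rule exE)
  then have w: "\<And>k. k < n \<Longrightarrow> w k \<in> carrier_vec n" "\<And>k. k < n \<Longrightarrow> w k \<noteq> 0\<^sub>v n"
    "\<And>k. k < n \<Longrightarrow> v k \<noteq> 0\<^sub>v n \<Longrightarrow> w k = v k"
    "\<And>k l. k < n \<Longrightarrow> l < n \<Longrightarrow> k \<noteq> l \<Longrightarrow> braket (w k) (w l) = 0"
    by simp_all
  define s where "s k = sqrt (\<Sum>i<n. (cmod (w k $ i))\<^sup>2)" for k
  have s: "braket (w k) (w k) = (complex_of_real (s k))\<^sup>2" if "k < n" for k
    unfolding braket_self[OF w(1)[OF that]] s_def of_real_power[symmetric]
    by (simp add: sum_nonneg)
  have s0: "s k \<noteq> 0" if "k < n" for k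
    using s[OF that] braket_self_eq_0_iff[OF w(1)[OF that]] w(2)[OF that] by auto
  define U where "U = mat n n (\<lambda>(i, k). w k $ i / complex_of_real (s k))"
  have colU: "col U k = inverse (complex_of_real (s k)) \<cdot>\<^sub>v w k" if "k < n" for k
    using that w(1)[OF that] by (intro eq_vecI) (auto simp: U_def field_simps)
  have "unitary_mat n U"
    unfolding unitary_mat_iff_orthonormal_cols
  proof (intro conjI allI impI)
    show "U \<in> carrier_mat n n" unfolding U_def by simp
    fix k l assume "k < n" "l < n"
    then show "braket (col U k) (col U l) = (if k = l then 1 else 0)"
      using w(4)[of k l] s[of k] s0[of k]
      by (auto simp: colU braket_smult[OF w(1) w(1)] power2_eq_square field_simps)
  qed
  moreover have "v k = (if v k = 0\<^sub>v n then 0 else complex_of_real (s k)) \<cdot>\<^sub>v col U k"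
    if "k < n" for k
  proof (cases "v k = 0\<^sub>v n")
    case True
    then show ?thesis using colU[OF that] w(1)[OF that] by (intro eq_vecI) auto
  next
    case False
    then have "complex_of_real (s k) \<cdot>\<^sub>v col U k = v k"
      unfolding colU[OF that] smult_smult_assoc using s0[OF that] w(3)[OF that] by simp
    then show ?thesis using False by simp
  qed
  ultimately show thesis
    by (rule that[of U "\<lambda>k. if v k = 0\<^sub>v n then 0 else complex_of_real (s k)"])
qed

lemma unit_vector_first_column_SU:
  assumes a: "a \<in> carrier_vec n" "braket a a = 1" and n: "n \<ge> 2"
  obtains V where "V \<in> SU n" "col V 0 = a"
proof -
  \<comment> \<open>Padding with zero vectors keeps the family orthogonal, so completing
    \<open>a\<close> to a basis is an instance of the previous lemma.\<close>
  define v where "v k = (if k = 0 then a else 0\<^sub>v n)" for k :: nat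
  have zero: "braket u (0\<^sub>v n) = 0" "braket (0\<^sub>v n) u = 0" if "u \<in> carrier_vec n" for u
    using that by (auto simp: braket_eq_sum[of _ n])
  obtain U r where U: "unitary_mat n U" and r: "\<And>k. k < n \<Longrightarrow> v k = r k \<cdot>\<^sub>v col U k"
    by (rule orthogonal_family_unitary_cols[of n v]) (use a zero in \<open>auto simp: v_def\<close>)
  note C = unitary_mat_carrier[OF U]
  have ar: "a = r 0 \<cdot>\<^sub>v col U 0" using r[of 0] n by (simp add: v_def)
  have "braket a a = cnj (r 0) * r 0 * braket (col U 0) (col U 0)"
    using C n unfolding ar by (intro braket_smult[of _ n]) auto
  also have "braket (col U 0) (col U 0) = 1"
    using U n unfolding unitary_mat_iff_orthonormal_cols by auto
  finally have "complex_of_real ((cmod (r 0))\<^sup>2) = 1"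
    using a(2) by (simp only: complex_norm_square mult.commute mult_1_left)
  then have "(cmod (r 0))\<^sup>2 = 1" by (simp only: of_real_eq_1_iff)
  then have r0: "cmod (r 0) = 1" using power_eq_imp_eq_base[of "cmod (r 0)" 2 1] by simp
  \<comment> \<open>Column 0 of \<open>U\<close> agrees with \<open>a\<close> only up to the phase
    \<open>r 0\<close>, which is put back here.\<close>
  define W where "W = U * mat_diag n (\<lambda>k. if k = 0 then r 0 else 1)"
  have W: "unitary_mat n W"
    unfolding W_def by (rule unitary_mat_mult_mat_diag[OF U]) (simp add: r0)
  have "col W 0 = a"
    unfolding W_def ar using col_mult_mat_diag[OF C] n by simp
  \<comment> \<open>Correcting the determinant in column 1, which exists as
    \<open>n \<ge> 2\<close>, preserves column 0.\<close>
  moreover obtain V c where "V \<in> SU n" "\<And>k. k < n \<Longrightarrow> k \<noteq> 1 \<Longrightarrow> col V k = col W k"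
    by (rule unitary_mat_adjust_det[OF W, of 1]) (use n in auto)
  ultimately show thesis using that n by simp
qed

section \<open>Coordinates of the circuit output and of the state as polynomials in z\<close>

lemma circuit_carrier:
  assumes "A \<in> carrier_mat (2 ^ b) (2 ^ b)" "B \<in> carrier_mat (2 ^ b) (2 ^ b)"
  shows "(A * w_tilde b z * B) *\<^sub>v unit_vec (2 ^ b) 0 \<in> carrier_vec (2 ^ b)"
  using assms unfolding w_tilde_def by (intro mult_mat_vec_carrier mult_carrier_mat) auto

text \<open>The diagonal factor scales column \<open>k\<close> of \<open>A\<close> by
  \<open>z ^ k\<close>, and the unit vector selects the first column of \<open>B\<close>. The form
  matches \<open>vec_poly_eval_index\<close>, so that coefficients can be compared.\<close>

lemma circuit_index:
  assumes A: "A \<in> carrier_mat (2 ^ b) (2 ^ b)" and B: "B \<in> carrier_mat (2 ^ b) (2 ^ b)"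
    and i: "i < 2 ^ b"
  shows "((A * w_tilde b z * B) *\<^sub>v unit_vec (2 ^ b) 0) $ i =
           (\<Sum>k<2 ^ b. A $$ (i, k) * B $$ (k, 0) * z ^ k)"
proof -
  have M: "A * w_tilde b z * B \<in> carrier_mat (2 ^ b) (2 ^ b)"
    using A B unfolding w_tilde_def by (intro mult_carrier_mat) auto
  have "(A * w_tilde b z * B) *\<^sub>v unit_vec (2 ^ b) 0 = col (A * w_tilde b z * B) 0"
    using M by (intro mult_mat_unit_vec) auto
  then show ?thesis
    using A B i unfolding w_tilde_def mat_diag_mult_right[OF A]
    by (auto simp: scalar_prod_def atLeast0LessThan mult_ac intro!: sum.cong)
qed

text \<open>For the zero polynomial this holds whatever value the unspecified degree takes.\<close>

lemma vec_poly_coeff_eq_0: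
  assumes "vec_poly m \<gamma>" "vec_poly_degree m \<gamma> < k"
  shows "\<gamma> k = 0\<^sub>v m"
proof (rule ccontr)
  assume "\<gamma> k \<noteq> 0\<^sub>v m"
  then have "k \<le> vec_poly_degree m \<gamma>"
    using assms(1) unfolding vec_poly_def vec_poly_degree_def by (intro Max_ge) auto
  then show False using assms(2) by simp
qed

lemma vec_poly_eval_carrier:
  assumes "vec_poly m \<gamma>"
  shows "vec_poly_eval m \<gamma> z \<in> carrier_vec m"
  using assms unfolding vec_poly_eval_def vec_poly_def by (intro finsum_vec_closed) auto

text \<open>The support lies below \<open>n\<close> by the degree bound, and the indices added to it
  contribute zero terms.\<close>

lemma vec_poly_eval_index:
  assumes \<gamma>: "vec_poly m \<gamma>" "vec_poly_degree m \<gamma> < n" and i: "i < m"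
  shows "vec_poly_eval m \<gamma> z $ i = (\<Sum>k<n. \<gamma> k $ i * z ^ k)"
proof -
  let ?S = "{k. \<gamma> k \<noteq> 0\<^sub>v m}"
  have \<gamma>c: "\<gamma> k \<in> carrier_vec m" for k using \<gamma> unfolding vec_poly_def by blast
  have "vec_poly_eval m \<gamma> z $ i = (\<Sum>k\<in>?S. (z ^ k \<cdot>\<^sub>v \<gamma> k) $ i)"
    unfolding vec_poly_eval_def
    using \<gamma> i unfolding vec_poly_def by (intro index_finsum_vec) auto
  also have "\<dots> = (\<Sum>k\<in>?S. \<gamma> k $ i * z ^ k)"
    using i \<gamma>c by (intro sum.cong) (auto simp: carrier_vecD[OF \<gamma>c])
  also have "\<dots> = (\<Sum>k<n. \<gamma> k $ i * z ^ k)"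
  proof (rule sum.mono_neutral_left)
    show "?S \<subseteq> {..<n}"
    proof
      fix k assume "k \<in> ?S"
      then have "k \<le> vec_poly_degree m \<gamma>"
        using vec_poly_coeff_eq_0[OF \<gamma>(1), of k] by (auto simp: not_less[symmetric])
      then show "k \<in> {..<n}" using \<gamma>(2) by simp
    qed
    show "\<forall>k\<in>{..<n} - ?S. \<gamma> k $ i * z ^ k = 0" using i by simp
  qed simp
  finally show ?thesis .
qed

text \<open>A nonzero polynomial of degree less than \<open>n\<close> cannot vanish at all \<open>n\<close>-th roots of unity.\<close>

lemma coeffs_eq_if_eq_on_U1:
  assumes eq: "\<And>z. z \<in> U1 \<Longrightarrow> (\<Sum>k<n. f k * z ^ k) = (\<Sum>k<n. g k * z ^ k)" and k: "k < n"
  shows "f k = g k"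
proof -
  define p where "p = (\<Sum>k<n. monom (f k - g k) k)"
  have coeff: "coeff p k = f k - g k" if "k < n" for k
    using that unfolding p_def coeff_sum by simp
  have root: "poly p z = 0" if "z \<in> U1" for z
    using eq[OF that] unfolding p_def poly_sum poly_monom
    by (simp add: left_diff_distrib sum_subtractf)
  have "p = 0"
  proof (rule ccontr)
    assume p: "p \<noteq> 0"
    \<comment> \<open>The \<open>n\<close>-th roots of unity lie in \<open>U1\<close>, so all
      \<open>n\<close> of them are roots of \<open>p\<close>, more than its degree allows.\<close>
    have "{z::complex. z ^ n = 1} \<subseteq> {z. poly p z = 0}"
    proof
      fix z :: complex assume "z \<in> {z. z ^ n = 1}"
      then have "cmod z ^ n = 1 ^ n" unfolding norm_power[symmetric] by simp
      then have "cmod z = 1" by (rule power_eq_imp_eq_base) (use k in auto)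
      then show "z \<in> {z. poly p z = 0}" using root by (simp add: U1_def)
    qed
    then have "card {z::complex. z ^ n = 1} \<le> card {z. poly p z = 0}"
      by (rule card_mono[OF poly_roots_finite[OF p]])
    also have "\<dots> \<le> degree p" using poly_roots_degree[OF p] .
    also have "\<dots> < n"
      unfolding p_def using k
      by (intro degree_sum_less) (auto intro: le_less_trans[OF degree_monom_le])
    finally have "card {z::complex. z ^ n = 1} < n" .
    moreover have "card {z::complex. z ^ n = 1} = n"
      by (rule card_roots_unity_eq) (use k in simp)
    ultimately show False by simp
  qed
  then show ?thesis using coeff[OF k] by simp
qed

theorem theorem7:
  fixes b :: nat and \<gamma> :: "nat \<Rightarrow> complex vec"
  assumes "b \<ge> 1"
    and "polynomial_state (2 ^ b) \<gamma>"
    and "vec_poly_degree (2 ^ b) \<gamma> \<le> 2 ^ b - 1"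
  shows "(\<exists>A0\<in>SU (2 ^ b). \<exists>A1\<in>SU (2 ^ b). \<forall>z\<in>U1.
            (A1 * w_tilde b z * A0) *\<^sub>v unit_vec (2 ^ b) 0 = vec_poly_eval (2 ^ b) \<gamma> z)
     \<longleftrightarrow> (\<forall>k\<le>2 ^ b - 1. \<forall>l\<le>2 ^ b - 1. k \<noteq> l \<longrightarrow> braket (\<gamma> k) (\<gamma> l) = 0)"
    (is "?L \<longleftrightarrow> ?R")
proof -
  define n :: nat where "n = 2 ^ b"
  have n: "n \<ge> 2" unfolding n_def using assms(1) by (cases b) auto
  have le_iff: "k \<le> 2 ^ b - 1 \<longleftrightarrow> k < n" for k
    using n unfolding n_def by auto
  have vp: "vec_poly n \<gamma>" and st: "\<And>z. z \<in> U1 \<Longrightarrow>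
      braket (vec_poly_eval n \<gamma> z) (vec_poly_eval n \<gamma> z) = 1"
    using assms(2) unfolding polynomial_state_def n_def by auto
  have \<gamma>c: "\<gamma> k \<in> carrier_vec n" for k using vp unfolding vec_poly_def by blast
  have deg: "vec_poly_degree n \<gamma> < n" using assms(3) n unfolding n_def by auto
  have SUc: "A \<in> carrier_mat n n" if "A \<in> SU n" for A
    using that unitary_mat_carrier unfolding SU_def by blast
  have U1_1: "1 \<in> U1" unfolding U1_def by simp
  have R_iff: "?R \<longleftrightarrow> (\<forall>k<n. \<forall>l<n. k \<noteq> l \<longrightarrow> braket (\<gamma> k) (\<gamma> l) = 0)"
    unfolding le_iff ..
  note circuit_n = circuit_index[where b = b, folded n_def]
  have "?L \<longleftrightarrow> (\<forall>k<n. \<forall>l<n. k \<noteq> l \<longrightarrow> braket (\<gamma> k) (\<gamma> l) = 0)"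
    unfolding n_def[symmetric]
  proof
    assume "\<exists>A0\<in>SU n. \<exists>A1\<in>SU n. \<forall>z\<in>U1.
      (A1 * w_tilde b z * A0) *\<^sub>v unit_vec n 0 = vec_poly_eval n \<gamma> z"
    then obtain A0 A1 where A: "A0 \<in> SU n" "A1 \<in> SU n" and
      eq: "\<And>z. z \<in> U1 \<Longrightarrow> (A1 * w_tilde b z * A0) *\<^sub>v unit_vec n 0 = vec_poly_eval n \<gamma> z"
      by blast
    note C = SUc[OF A(1)] SUc[OF A(2)]
    have \<gamma>_col: "\<gamma> k = A0 $$ (k, 0) \<cdot>\<^sub>v col A1 k" if k: "k < n" for k
    proof (rule eq_vecI)
      fix i assume "i < dim_vec (A0 $$ (k, 0) \<cdot>\<^sub>v col A1 k)"
      then have i: "i < n" using C by simp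
      \<comment> \<open>Coordinate \<open>i\<close> of both sides is a polynomial in z, and the two
        agree on \<open>U1\<close>.\<close>
      have "A1 $$ (i, k) * A0 $$ (k, 0) = \<gamma> k $ i"
        using eq circuit_n[OF C(2,1) i] vec_poly_eval_index[OF vp deg i] k
        by (intro coeffs_eq_if_eq_on_U1[where n = n and f = "\<lambda>k. A1 $$ (i, k) * A0 $$ (k, 0)" and
              g = "\<lambda>k. \<gamma> k $ i"])
           metis+
      then show "\<gamma> k $ i = (A0 $$ (k, 0) \<cdot>\<^sub>v col A1 k) $ i"
        using C i k by (simp add: mult.commute)
    qed (use \<gamma>c[of k] C in auto)
    have "unitary_mat n A1" using A(2) unfolding SU_def by blast
    then have "braket (col A1 k) (col A1 l) = 0" if "k < n" "l < n" "k \<noteq> l" for k l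
      using that unfolding unitary_mat_iff_orthonormal_cols by auto
    then show "\<forall>k<n. \<forall>l<n. k \<noteq> l \<longrightarrow> braket (\<gamma> k) (\<gamma> l) = 0"
      using C by (simp add: \<gamma>_col braket_smult[of _ n])
  next
    assume orth: "\<forall>k<n. \<forall>l<n. k \<noteq> l \<longrightarrow> braket (\<gamma> k) (\<gamma> l) = 0"
    obtain U r where U: "unitary_mat n U" and r: "\<And>k. k < n \<Longrightarrow> \<gamma> k = r k \<cdot>\<^sub>v col U k"
      by (rule orthogonal_family_unitary_cols[of n \<gamma>]) (use orth \<gamma>c in auto)
    obtain A1 c where A1: "A1 \<in> SU n" and c: "c \<noteq> 0" "col A1 0 = c \<cdot>\<^sub>v col U 0"
      "\<And>k. k < n \<Longrightarrow> k \<noteq> 0 \<Longrightarrow> col A1 k = col U k"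
      by (rule unitary_mat_adjust_det[OF U, of 0]) (use n in auto)
    note C1 = SUc[OF A1]
    \<comment> \<open>Column 0 of \<open>A1\<close> is \<open>c\<close> times that of
      \<open>U\<close>; dividing \<open>r 0\<close> by \<open>c\<close> keeps the product equal to
      the coefficient vector at index 0.\<close>
    define a where "a = vec n (\<lambda>k. if k = 0 then r 0 / c else r k)"
    have a: "a \<in> carrier_vec n" unfolding a_def by simp
    have \<gamma>_col: "\<gamma> k = a $ k \<cdot>\<^sub>v col A1 k" if "k < n" for k
      using r[OF that] c that by (cases "k = 0") (auto simp: a_def smult_smult_assoc)
    have \<gamma>_index: "\<gamma> k $ i = A1 $$ (i, k) * a $ k" if "k < n" "i < n" for k i
      using C1 that by (simp add: \<gamma>_col mult.commute)
    \<comment> \<open>At z = 1 all powers of z are 1, so the state is the combination of the columns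
      of \<open>A1\<close> with weights \<open>a\<close>.\<close>
    have "vec_poly_eval n \<gamma> 1 = A1 *\<^sub>v a"
    proof (rule eq_vecI)
      fix i assume "i < dim_vec (A1 *\<^sub>v a)"
      then have "i < n" using C1 by simp
      then show "vec_poly_eval n \<gamma> 1 $ i = (A1 *\<^sub>v a) $ i"
        using C1 a \<gamma>_index
        by (auto simp: vec_poly_eval_index[OF vp deg] scalar_prod_def atLeast0LessThan
            intro!: sum.cong)
    qed (use C1 vec_poly_eval_carrier[OF vp, of 1] in auto)
    then have "braket a a = 1"
      using st[OF U1_1] braket_unitary_mat_mult[OF _ a, of A1] A1 unfolding SU_def by simp
    then obtain A0 where A0: "A0 \<in> SU n" and col0: "col A0 0 = a"
      using unit_vector_first_column_SU[OF a _ n] by blast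
    note C0 = SUc[OF A0]
    have A0_a: "A0 $$ (k, 0) = a $ k" if "k < n" for k
      using C0 that n unfolding col0[symmetric] by simp
    \<comment> \<open>The coefficients on both sides coincide, so the identity holds for every
      complex z, in particular on \<open>U1\<close>.\<close>
    have "(A1 * w_tilde b z * A0) *\<^sub>v unit_vec n 0 = vec_poly_eval n \<gamma> z" for z
    proof (rule eq_vecI)
      fix i assume "i < dim_vec (vec_poly_eval n \<gamma> z)"
      then have i: "i < n" using vec_poly_eval_carrier[OF vp, of z] by simp
      show "((A1 * w_tilde b z * A0) *\<^sub>v unit_vec n 0) $ i = vec_poly_eval n \<gamma> z $ i"
        unfolding circuit_n[OF C1 C0 i] vec_poly_eval_index[OF vp deg i]
        using i by (intro sum.cong) (auto simp: A0_a \<gamma>_index)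
    next
      show "dim_vec ((A1 * w_tilde b z * A0) *\<^sub>v unit_vec n 0) = dim_vec (vec_poly_eval n \<gamma> z)"
        using circuit_carrier[of A1 b A0 z] C1 C0 vec_poly_eval_carrier[OF vp, of z]
        unfolding n_def by simp
    qed
    then show "\<exists>A0\<in>SU n. \<exists>A1\<in>SU n. \<forall>z\<in>U1.
        (A1 * w_tilde b z * A0) *\<^sub>v unit_vec n 0 = vec_poly_eval n \<gamma> z"
      using A0 A1 by blast
  qed
  then show ?thesis unfolding R_iff .
qed

end
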